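(* A poset $\mathbb P$ is almost $\omega^\omega$-bounding if and only if $\mathbb P$ preserves all unbounded families of the ground model as unbounded families in the extension, i.e. for every $X\subset\omega^\omega$ in the ground model $V$ that is unbounded in $V$, $X$ is forced by $\mathbb P$ to be unbounded in $V^{\mathbb P}$.
   Context: For $x,y\in\omega^\omega$, $x\le^*y$ means $x(n)\le y(n)$ for all but finitely many $n$. A family $X\subset\omega^\omega$ is unbounded if there is no $y\in\omega^\omega$ with $x\le^*y$ for all $x\in X$. A poset $\mathbb P$ is almost $\omega^\omega$-bounding if for every $\mathbb P$-name $\dot f$ for a real (element of $\omega^\omega$) and every $q\in\mathbb P$ there exists $g:\omega\to\omega$ (in the ground model) such that for every (ground model) $A\in[\omega]^\omega$ there is $q_A\le q$ (i.e. stronger than $q$) with $q_A\Vdash g\restriction A\not<^*\dot f\restriction A$. Here $g\restriction A<^*f\restriction A$ means $g(n)<f(n)$ for all but finitely many $n\in A$. *)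

theory Defs
  imports "HOL-Library.Infinite_Set" "HOL-Library.Countable_Set" "HOL-Library.Multiset"
begin

text \<open>
  The ground model \<open>V\<close> is the HOL universe. A poset is a carrier \<open>P\<close> with a relation \<open>r\<close>
  satisfying \<^term>\<open>partial_order_on P r\<close>, where \<open>(q, p) \<in> r\<close> means \<open>q \<le> p\<close>, that is,
  \<open>q\<close> is the stronger condition.
\<close>

section \<open>Names\<close>

text \<open>
  A name is hereditarily a set of pairs (name, condition). As no HOL type can contain
  all subsets of itself, the number of names that occur as first components is bounded by the
  size of the index type \<open>'i\<close>: \<open>Name t c\<close> stands for \<open>{(t i, s) | s \<in> c i}\<close>.
  The type \<open>'i\<close> is kept arbitrary; each set-sized name is available once \<open>'i\<close> is large enough.
  A condition \<open>s\<close> outside the carrier has no effect, since no \<open>q\<close> satisfies \<open>(q, s) \<in> r\<close>.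
  \<open>Empty\<close> is only there because a datatype needs a base case.
\<close>

datatype ('i, 'p) pname =
    Empty
  | Name "'i \<Rightarrow> ('i, 'p) pname" "'i \<Rightarrow> 'p set"

primrec elems :: "('i, 'p) pname \<Rightarrow> (('i, 'p) pname \<times> 'p) set" where
  "elems Empty = {}"
| "elems (Name t c) = {(t i, s) | i s. s \<in> c i}"

definition elem_rel :: "('i, 'p) pname rel" where
  "elem_rel = {(\<pi>, \<tau>). \<exists>s. (\<pi>, s) \<in> elems \<tau>}"

lemma wf_elem_rel: "wf (elem_rel :: ('i, 'p) pname rel)"
proof (rule wfUNIVI)
  fix Q :: "('i, 'p) pname \<Rightarrow> bool" and \<tau> :: "('i, 'p) pname"
  assume "\<forall>\<tau>. (\<forall>\<pi>. (\<pi>, \<tau>) \<in> elem_rel \<longrightarrow> Q \<pi>) \<longrightarrow> Q \<tau>"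
  then have step: "Q \<tau>" if "\<And>\<pi> s. (\<pi>, s) \<in> elems \<tau> \<Longrightarrow> Q \<pi>" for \<tau>
    using that unfolding elem_rel_def by blast
  show "Q \<tau>"
    by (induction \<tau>) (rule step; auto)+
qed

text \<open>
  The name that is extensionally the given set of pairs (up to enumeration). It is meaningful when
  at most \<open>|'i|\<close> names occur in \<open>S\<close>; see \<open>elems_name_of\<close> for the countable case.
\<close>

definition name_of :: "(('i, 'p) pname \<times> 'p) set \<Rightarrow> ('i, 'p) pname" where
  "name_of S = (SOME \<tau>. elems \<tau> = S)"

lemma elems_name_of:
  fixes S :: "(('i, 'p) pname \<times> 'p) set"
  assumes "infinite (UNIV :: 'i set)" and "countable (fst ` S)"
  shows "elems (name_of S) = S"
proof -
  obtain e :: "nat \<Rightarrow> 'i" where e: "inj e"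
    using assms(1) infinite_countable_subset by blast
  obtain d :: "nat \<Rightarrow> ('i, 'p) pname" where d: "fst ` S \<subseteq> range d"
    using assms(2) by (metis countable_def from_nat_into_surj subsetI rangeI)
  define t where "t i = d (inv e i)" for i
  have ti: "t (e n) = d n" for n
    using e by (simp add: t_def)
  have "elems (Name t (\<lambda>i. {s. (t i, s) \<in> S})) = S"
  proof (intro set_eqI iffI)
    fix x assume "x \<in> S"
    moreover from this obtain n where "fst x = t (e n)"
      using d ti by (metis imageE image_eqI subsetD)
    ultimately show "x \<in> elems (Name t (\<lambda>i. {s. (t i, s) \<in> S}))"
      by (cases x) auto
  qed auto
  then show ?thesis
    unfolding name_of_def by (rule someI)
qed

text \<open>
  Canonical names. Pairing every element with every condition makes a greatest condition
  unnecessary. Naturals are von Neumann ordinals, pairs are Kuratowski pairs.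
\<close>

definition check_of :: "('i, 'p) pname set \<Rightarrow> ('i, 'p) pname" where
  "check_of S = name_of (S \<times> UNIV)"

fun nat_name :: "nat \<Rightarrow> ('i, 'p) pname" where
  "nat_name n = check_of (nat_name ` {..<n})"

declare nat_name.simps [simp del]

definition pair_name :: "nat \<Rightarrow> nat \<Rightarrow> ('i, 'p) pname" where
  "pair_name n m = check_of {check_of {nat_name n}, check_of {nat_name n, nat_name m}}"

definition real_name :: "(nat \<Rightarrow> nat) \<Rightarrow> ('i, 'p) pname" where
  "real_name x = check_of (range (\<lambda>n. pair_name n (x n)))"


section \<open>The forcing relation\<close>

text \<open>
  The usual recursion: \<open>p\<close> forces \<open>\<pi> \<in> \<sigma>\<close> iff the conditions \<open>q\<close> such that \<open>q \<le> u\<close> and \<open>q\<close> forces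
  \<open>\<pi> = \<rho>\<close> for some \<open>(\<rho>, u) \<in> \<sigma>\<close> are dense below \<open>p\<close>; and \<open>p\<close> forces \<open>\<tau> = \<sigma>\<close> iff for each
  \<open>(\<pi>, s) \<in> \<tau>\<close>, all \<open>q \<le> p, s\<close> force \<open>\<pi> \<in> \<sigma>\<close>, and vice versa.
\<close>

function forces_mem :: "'p rel \<Rightarrow> 'p \<Rightarrow> ('i, 'p) pname \<Rightarrow> ('i, 'p) pname \<Rightarrow> bool"
  and forces_eq :: "'p rel \<Rightarrow> 'p \<Rightarrow> ('i, 'p) pname \<Rightarrow> ('i, 'p) pname \<Rightarrow> bool" where
  "forces_mem r p \<pi> \<sigma> \<longleftrightarrow>
     (\<forall>q'. (q', p) \<in> r \<longrightarrow>
       (\<exists>q. (q, q') \<in> r \<and> (\<exists>(\<rho>, u) \<in> elems \<sigma>. (q, u) \<in> r \<and> forces_eq r q \<pi> \<rho>)))"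
| "forces_eq r p \<tau> \<sigma> \<longleftrightarrow>
     (\<forall>(\<pi>, s) \<in> elems \<tau>. \<forall>q. (q, p) \<in> r \<and> (q, s) \<in> r \<longrightarrow> forces_mem r q \<pi> \<sigma>) \<and>
     (\<forall>(\<pi>, s) \<in> elems \<sigma>. \<forall>q. (q, p) \<in> r \<and> (q, s) \<in> r \<longrightarrow> forces_mem r q \<pi> \<tau>)"
  by pat_completeness auto
termination
proof -
  let ?m = "case_sum (\<lambda>(r, p, \<tau>, \<sigma>). {#\<tau>, \<sigma>#}) (\<lambda>(r, p, \<tau>, \<sigma>). {#\<tau>, \<sigma>#})
    :: 'p rel \<times> 'p \<times> ('i, 'p) pname \<times> ('i, 'p) pname +
       'p rel \<times> 'p \<times> ('i, 'p) pname \<times> ('i, 'p) pname \<Rightarrow> ('i, 'p) pname multiset"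
  have step: "({#\<pi>, \<sigma>#}, {#\<tau>, \<sigma>#}) \<in> mult elem_rel" "({#\<sigma>, \<pi>#}, {#\<sigma>, \<tau>#}) \<in> mult elem_rel"
    "({#\<pi>, \<sigma>#}, {#\<sigma>, \<tau>#}) \<in> mult elem_rel"
    if "(\<pi>, s) \<in> elems \<tau>" for \<pi> \<sigma> \<tau> :: "('i, 'p) pname" and s
  proof -
    have "(\<pi>, \<tau>) \<in> elem_rel"
      using that by (auto simp: elem_rel_def)
    then have "({#\<sigma>#} + {#\<pi>#}, {#\<sigma>#} + {#\<tau>#}) \<in> mult elem_rel"
      by (intro one_step_implies_mult) auto
    then show "({#\<pi>, \<sigma>#}, {#\<tau>, \<sigma>#}) \<in> mult elem_rel" "({#\<sigma>, \<pi>#}, {#\<sigma>, \<tau>#}) \<in> mult elem_rel"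
      "({#\<pi>, \<sigma>#}, {#\<sigma>, \<tau>#}) \<in> mult elem_rel"
      by (simp_all add: add_mset_commute)
  qed
  show ?thesis
    by (relation "inv_image (mult elem_rel) ?m")
       (auto simp: wf_mult wf_elem_rel intro: step)
qed

declare forces_mem.simps [simp del] forces_eq.simps [simp del]

text \<open>
  Sentences of the forcing language, with names as parameters. \<open>AllName\<close> quantifies over the
  extension. \<open>AllNat A\<close> and \<open>AllReal X\<close> are the bounded quantifiers over the ground model sets
  \<open>A \<subseteq> \<omega>\<close> and \<open>X \<subseteq> \<omega>\<^sup>\<omega>\<close>: a condition forces \<open>\<forall>x \<in> X. \<phi>(x)\<close> for a ground model set \<open>X\<close> iff it
  forces \<open>\<phi>(x)\<close> for each \<open>x \<in> X\<close>.
\<close>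

datatype ('i, 'p) sentence =
    Mem "('i, 'p) pname" "('i, 'p) pname"
  | Eq "('i, 'p) pname" "('i, 'p) pname"
  | Neg "('i, 'p) sentence"
  | Conj "('i, 'p) sentence" "('i, 'p) sentence"
  | AllName "('i, 'p) pname \<Rightarrow> ('i, 'p) sentence"
  | AllNat "nat set" "nat \<Rightarrow> ('i, 'p) sentence"
  | AllReal "(nat \<Rightarrow> nat) set" "(nat \<Rightarrow> nat) \<Rightarrow> ('i, 'p) sentence"

primrec forces :: "'p rel \<Rightarrow> 'p \<Rightarrow> ('i, 'p) sentence \<Rightarrow> bool" where
  "forces r p (Mem \<tau> \<sigma>) \<longleftrightarrow> forces_mem r p \<tau> \<sigma>"
| "forces r p (Eq \<tau> \<sigma>) \<longleftrightarrow> forces_eq r p \<tau> \<sigma>"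
| "forces r p (Neg \<phi>) \<longleftrightarrow> (\<forall>q. (q, p) \<in> r \<longrightarrow> \<not> forces r q \<phi>)"
| "forces r p (Conj \<phi> \<psi>) \<longleftrightarrow> forces r p \<phi> \<and> forces r p \<psi>"
| "forces r p (AllName \<Phi>) \<longleftrightarrow> (\<forall>\<tau>. forces r p (\<Phi> \<tau>))"
| "forces r p (AllNat A \<Phi>) \<longleftrightarrow> (\<forall>n \<in> A. forces r p (\<Phi> n))"
| "forces r p (AllReal X \<Phi>) \<longleftrightarrow> (\<forall>x \<in> X. forces r p (\<Phi> x))"

definition Imp :: "('i, 'p) sentence \<Rightarrow> ('i, 'p) sentence \<Rightarrow> ('i, 'p) sentence" where
  "Imp \<phi> \<psi> = Neg (Conj \<phi> (Neg \<psi>))"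

definition ExName :: "(('i, 'p) pname \<Rightarrow> ('i, 'p) sentence) \<Rightarrow> ('i, 'p) sentence" where
  "ExName \<Phi> = Neg (AllName (\<lambda>\<tau>. Neg (\<Phi> \<tau>)))"

definition ExNat :: "nat set \<Rightarrow> (nat \<Rightarrow> ('i, 'p) sentence) \<Rightarrow> ('i, 'p) sentence" where
  "ExNat A \<Phi> = Neg (AllNat A (\<lambda>n. Neg (\<Phi> n)))"


section \<open>Reals in the extension\<close>

text \<open>\<open>\<tau> \<in> \<omega>\<^sup>\<omega>\<close>: \<open>\<tau>\<close> is a set of pairs of naturals that is a total function.\<close>

definition is_real :: "('i, 'p) pname \<Rightarrow> ('i, 'p) sentence" where
  "is_real \<tau> =
     Conj
       (AllName (\<lambda>z. Imp (Mem z \<tau>)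
          (ExNat UNIV (\<lambda>n. ExNat UNIV (\<lambda>m. Eq z (pair_name n m))))))
       (AllNat UNIV (\<lambda>n. ExNat UNIV (\<lambda>m.
          Conj (Mem (pair_name n m) \<tau>)
               (AllNat (- {m}) (\<lambda>m'. Neg (Mem (pair_name n m') \<tau>))))))"

text \<open>\<open>R (\<sigma>(n)) (\<tau>(n))\<close> for all but finitely many \<open>n \<in> A\<close>, where \<open>\<sigma>\<close>, \<open>\<tau>\<close> are reals.\<close>

definition almost_all_on ::
    "(nat \<Rightarrow> nat \<Rightarrow> bool) \<Rightarrow> nat set \<Rightarrow> ('i, 'p) pname \<Rightarrow> ('i, 'p) pname \<Rightarrow> ('i, 'p) sentence" where
  "almost_all_on R A \<sigma> \<tau> =
     ExNat UNIV (\<lambda>N. AllNat {n \<in> A. N \<le> n} (\<lambda>n.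
       ExNat UNIV (\<lambda>k. ExNat {m. R k m} (\<lambda>m.
         Conj (Mem (pair_name n k) \<sigma>) (Mem (pair_name n m) \<tau>)))))"

abbreviation less_star_on ::
    "nat set \<Rightarrow> ('i, 'p) pname \<Rightarrow> ('i, 'p) pname \<Rightarrow> ('i, 'p) sentence" where
  "less_star_on A \<sigma> \<tau> \<equiv> almost_all_on (<) A \<sigma> \<tau>"

abbreviation le_star_sentence ::
    "('i, 'p) pname \<Rightarrow> ('i, 'p) pname \<Rightarrow> ('i, 'p) sentence" where
  "le_star_sentence \<sigma> \<tau> \<equiv> almost_all_on (\<le>) UNIV \<sigma> \<tau>"

definition unbounded_sentence :: "(nat \<Rightarrow> nat) set \<Rightarrow> ('i, 'p) sentence" where
  "unbounded_sentence X =
     Neg (ExName (\<lambda>y. Conj (is_real y) (AllReal X (\<lambda>x. le_star_sentence (real_name x) y))))"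


section \<open>Bounding properties\<close>

definition le_star :: "(nat \<Rightarrow> nat) \<Rightarrow> (nat \<Rightarrow> nat) \<Rightarrow> bool" where
  "le_star x y \<longleftrightarrow> (\<forall>\<^sub>\<infinity>n. x n \<le> y n)"

definition unbounded :: "(nat \<Rightarrow> nat) set \<Rightarrow> bool" where
  "unbounded X \<longleftrightarrow> \<not> (\<exists>y. \<forall>x \<in> X. le_star x y)"

definition is_name_for_real :: "'p set \<Rightarrow> 'p rel \<Rightarrow> ('i, 'p) pname \<Rightarrow> bool" where
  "is_name_for_real P r \<tau> \<longleftrightarrow> (\<forall>p \<in> P. forces r p (is_real \<tau>))"

text \<open>The argument of type \<^typ>\<open>'i itself\<close> only fixes the size of the names considered.\<close>

definition almost_bounding :: "'i itself \<Rightarrow> 'p set \<Rightarrow> 'p rel \<Rightarrow> bool" where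
  "almost_bounding _ P r \<longleftrightarrow>
     (\<forall>f :: ('i, 'p) pname. is_name_for_real P r f \<longrightarrow>
       (\<forall>q \<in> P. \<exists>g :: nat \<Rightarrow> nat. \<forall>A. infinite A \<longrightarrow>
          (\<exists>q\<^sub>A. (q\<^sub>A, q) \<in> r \<and> forces r q\<^sub>A (Neg (less_star_on A (real_name g) f)))))"

definition preserves_unbounded :: "'i itself \<Rightarrow> 'p set \<Rightarrow> 'p rel \<Rightarrow> bool" where
  "preserves_unbounded _ P r \<longleftrightarrow>
     (\<forall>X. unbounded X \<longrightarrow>
       (\<forall>p \<in> P. forces r p (unbounded_sentence X :: ('i, 'p) sentence)))"

end

theory Submission
  imports Defs
begin

text \<open>
  Suppose first that the poset is almost bounding, that \<open>X\<close> is unbounded, and that some condition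
  \<open>s\<close> forces a real \<open>y\<close> to bound \<open>X\<close>. Take \<open>g\<close> as in the definition of almost bounding, for \<open>y\<close>
  and \<open>s\<close>. Since \<open>g\<close> does not bound \<open>X\<close>, there is \<open>x \<in> X\<close> such that \<open>A = {n. g n < x n}\<close> is infinite.
  Below \<open>s\<close> we have \<open>g n < x n \<le> y n\<close> for almost all \<open>n \<in> A\<close>, so no condition below \<open>s\<close> forces
  the negation of \<open>g \<restriction> A <\<^sup>* y \<restriction> A\<close>: this contradicts the choice of \<open>g\<close>.

  Conversely, suppose that \<open>f\<close> and \<open>q\<close> witness that the poset is not almost bounding. Then each \<open>g\<close>
  has an infinite set \<open>A g\<close> for which \<open>q\<close> forces \<open>g \<restriction> A g <\<^sup>* f \<restriction> A g\<close>. Let \<open>x g\<close> agree with \<open>g\<close> on \<open>A g\<close>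
  and vanish elsewhere. The family of all \<open>x g\<close> is unbounded, because \<open>x (y + 1)\<close> exceeds \<open>y\<close> on
  the infinite set \<open>A (y + 1)\<close>; but \<open>q\<close> forces \<open>f\<close> to bound it.

  These computations do not need the forcing theorem: everything said about a real depends only on
  which conditions force which pairs \<open>(n, m)\<close> into its name. \<open>forces_eq_canonical\<close> shows that no
  condition confuses two canonical names, and \<open>forces_almost_all_on_real_name\<close> turns domination of
  a ground model real into a density statement about \<open>forces_mem\<close>. One step of the first direction
  needs care: \<open>y\<close> need only be a real below \<open>s\<close>, whereas almost bounding speaks of names that every
  condition forces to be reals. \<open>name_for_real_below\<close> supplies such a name, equivalent to \<open>y\<close> below
  \<open>s\<close>, by mixing \<open>y\<close> with the zero function.
\<close>


section \<open>The forcing relation on a poset\<close>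
lemma forces_eq_sym: "forces_eq r p \<tau> \<sigma> \<Longrightarrow> forces_eq r p \<sigma> \<tau>"
  unfolding forces_eq.simps[of r p] by blast

lemma forces_Imp:
  "forces r p (Imp \<phi> \<psi>) \<longleftrightarrow>
     (\<forall>q. (q, p) \<in> r \<longrightarrow> forces r q \<phi> \<longrightarrow> (\<exists>q'. (q', q) \<in> r \<and> forces r q' \<psi>))"
  by (auto simp: Imp_def)

lemma forces_ExName:
  "forces r p (ExName \<Phi>) \<longleftrightarrow> (\<forall>q. (q, p) \<in> r \<longrightarrow> (\<exists>q' \<tau>. (q', q) \<in> r \<and> forces r q' (\<Phi> \<tau>)))"
  by (simp add: ExName_def) blast

lemma forces_ExNat:
  "forces r p (ExNat A \<Phi>) \<longleftrightarrow>
     (\<forall>q. (q, p) \<in> r \<longrightarrow> (\<exists>q'. \<exists>n \<in> A. (q', q) \<in> r \<and> forces r q' (\<Phi> n)))"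
  by (simp add: ExNat_def) blast

context
  fixes P :: "'p set" and r :: "'p rel"
  assumes po: "partial_order_on P r"
begin

lemma le_trans: "(a, b) \<in> r \<Longrightarrow> (b, c) \<in> r \<Longrightarrow> (a, c) \<in> r"
  using po unfolding partial_order_on_def preorder_on_def by (meson transD)

lemma le_refl: "p \<in> P \<Longrightarrow> (p, p) \<in> r"
  using po unfolding partial_order_on_def preorder_on_def by (blast dest: refl_onD)

lemma le_carrier: "(a, b) \<in> r \<Longrightarrow> a \<in> P" "(a, b) \<in> r \<Longrightarrow> b \<in> P"
  using po unfolding partial_order_on_def preorder_on_def by auto

lemma le_self: "(a, b) \<in> r \<Longrightarrow> (a, a) \<in> r"
  using le_carrier le_refl by blast

lemma forces_mem_mono:
  assumes "forces_mem r p \<pi> \<sigma>" "(q, p) \<in> r"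
  shows "forces_mem r q \<pi> \<sigma>"
  using assms le_trans unfolding forces_mem.simps[of r p] forces_mem.simps[of r q] by meson

lemma forces_eq_mono:
  assumes "forces_eq r p \<tau> \<sigma>" "(q, p) \<in> r"
  shows "forces_eq r q \<tau> \<sigma>"
  using assms le_trans unfolding forces_eq.simps[of r p] forces_eq.simps[of r q] by blast

lemma forces_mono:
  assumes "forces r p \<phi>" "(q, p) \<in> r"
  shows "forces r q \<phi>"
  using assms
  by (induction \<phi>) (auto intro: forces_mem_mono forces_eq_mono le_trans)

text \<open>
  Forced membership is itself a density statement, and refining twice is refining once.
\<close>
lemma forces_mem_dense:
  assumes "\<And>q. (q, p) \<in> r \<Longrightarrow> \<exists>q'. (q', q) \<in> r \<and> forces_mem r q' \<pi> \<sigma>"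
  shows "forces_mem r p \<pi> \<sigma>"
  unfolding forces_mem.simps[of r p]
proof (intro allI impI)
  fix q assume "(q, p) \<in> r"
  then obtain q' where q': "(q', q) \<in> r" "forces_mem r q' \<pi> \<sigma>"
    using assms by blast
  then obtain q'' where "(q'', q') \<in> r"
      "\<exists>(\<rho>, u) \<in> elems \<sigma>. (q'', u) \<in> r \<and> forces_eq r q'' \<pi> \<rho>"
    using le_self unfolding forces_mem.simps[of r q'] by blast
  then show "\<exists>q'. (q', q) \<in> r \<and> (\<exists>(\<rho>, u) \<in> elems \<sigma>. (q', u) \<in> r \<and> forces_eq r q' \<pi> \<rho>)"
    using le_trans q'(1) by blast
qed

lemma forces_eq_refl: "forces_eq r p \<tau> \<tau>"
proof (induction \<tau> arbitrary: p rule: wf_induct[OF wf_elem_rel])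
  case (1 \<tau>)
  have "forces_mem r q \<pi> \<tau>" if "(\<pi>, s) \<in> elems \<tau>" "(q, s) \<in> r" for \<pi> s q
    unfolding forces_mem.simps[of r q]
  proof (intro allI impI)
    fix q' assume "(q', q) \<in> r"
    moreover have "forces_eq r q' \<pi> \<pi>"
      using 1 that(1) by (auto simp: elem_rel_def)
    ultimately show "\<exists>q. (q, q') \<in> r \<and> (\<exists>(\<rho>, u)\<in>elems \<tau>. (q, u) \<in> r \<and> forces_eq r q \<pi> \<rho>)"
      using that le_self le_trans by blast
  qed
  then show ?case
    unfolding forces_eq.simps[of r p] by blast
qed

lemma forces_ExNatI:
  assumes "n \<in> A" "forces r p (\<Phi> n)"
  shows "forces r p (ExNat A \<Phi>)"
  using assms forces_mono le_self unfolding forces_ExNat by blast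

end


section \<open>Canonical names\<close>

text \<open>
  The names obtained from the empty set by repeatedly forming canonical names of countable sets.
  Countability matters because \<^const>\<open>check_of\<close> has its intended elements only on sets
  small enough to be indexed by \<open>'i\<close>, and of \<open>'i\<close> only infinity is known.
\<close>
inductive canonical :: "('i, 'p) pname \<Rightarrow> bool" where
  "countable S \<Longrightarrow> (\<And>\<pi>. \<pi> \<in> S \<Longrightarrow> canonical \<pi>) \<Longrightarrow> canonical (check_of S)"

context
  assumes inf: "infinite (UNIV :: 'i set)"
begin

lemma elems_check_of:
  fixes S :: "('i, 'p) pname set"
  assumes "countable S"
  shows "elems (check_of S) = S \<times> UNIV"
  unfolding check_of_def by (rule elems_name_of[OF inf]) (simp add: assms)

lemma check_of_eq_iff:
  fixes S T :: "('i, 'p) pname set"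
  assumes "countable S" "countable T"
  shows "check_of S = check_of T \<longleftrightarrow> S = T"
  using elems_check_of[OF assms(1)] elems_check_of[OF assms(2)]
  by (metis fst_image_times UNIV_not_empty)

lemma elems_nat_name: "elems (nat_name n :: ('i, 'p) pname) = nat_name ` {..<n} \<times> UNIV"
  by (subst nat_name.simps) (simp add: elems_check_of)

text \<open>
  Equality of the names of \<open>n < m\<close> would make a name an element of itself.
\<close>
lemma nat_name_eq_iff: "(nat_name n :: ('i, 'p) pname) = nat_name m \<longleftrightarrow> n = m"
proof -
  have "(nat_name n :: ('i, 'p) pname) \<noteq> nat_name m" if "n < m" for n m
  proof
    assume eq: "(nat_name n :: ('i, 'p) pname) = nat_name m"
    have "(nat_name n, nat_name m :: ('i, 'p) pname) \<in> elem_rel"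
      using that by (auto simp: elem_rel_def elems_nat_name)
    with eq show False
      by (metis wf_elem_rel wf_not_refl)
  qed
  then show ?thesis
    by (metis linorder_neqE_nat)
qed

lemma pair_name_eq_iff:
  "(pair_name n m :: ('i, 'p) pname) = pair_name n' m' \<longleftrightarrow> n = n' \<and> m = m'"
  by (auto simp: pair_name_def check_of_eq_iff doubleton_eq_iff nat_name_eq_iff)

lemma canonical_nat_name: "canonical (nat_name n :: ('i, 'p) pname)"
  by (induction n rule: less_induct)
    (subst nat_name.simps, auto intro!: canonical.intros)

lemma canonical_pair_name: "canonical (pair_name n m :: ('i, 'p) pname)"
  unfolding pair_name_def by (auto intro!: canonical.intros canonical_nat_name)

context
  fixes P :: "'p set" and r :: "'p rel"
  assumes po: "partial_order_on P r"
begin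

lemma forces_mem_check_of:
  fixes S :: "('i, 'p) pname set"
  assumes "countable S"
  shows "forces_mem r p \<pi> (check_of S) \<longleftrightarrow>
    (\<forall>q. (q, p) \<in> r \<longrightarrow> (\<exists>q'. (q', q) \<in> r \<and> (\<exists>\<rho> \<in> S. forces_eq r q' \<pi> \<rho>)))"
  unfolding forces_mem.simps[of r p] elems_check_of[OF assms]
  using le_self[OF po] by blast

text \<open>
  Absoluteness of equality. By induction, whenever \<open>\<pi>\<close> is forced into the canonical name of \<open>T\<close>,
  some stronger condition forces \<open>\<pi>\<close> to equal an element of \<open>T\<close>, and then \<open>\<pi>\<close> is that element; so two
  canonical names that are forced to be equal have the same elements.
\<close>
lemma forces_eq_canonical:
  fixes \<sigma> \<tau> :: "('i, 'p) pname"
  assumes "canonical \<sigma>" "canonical \<tau>" "p \<in> P"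
  shows "forces_eq r p \<sigma> \<tau> \<longleftrightarrow> \<sigma> = \<tau>"
  using assms
proof (induction arbitrary: \<tau> p)
  case (1 S)
  from 1(4) obtain T where T: "\<tau> = check_of T" "countable T" "\<And>\<pi>. \<pi> \<in> T \<Longrightarrow> canonical \<pi>"
    by (auto elim: canonical.cases)
  have "S = T" if eq: "forces_eq r p (check_of S) (check_of T)"
  proof (intro set_eqI iffI)
    fix \<pi> assume "\<pi> \<in> S"
    then have "forces_mem r p \<pi> (check_of T)"
      using eq le_refl[OF po \<open>p \<in> P\<close>]
      unfolding forces_eq.simps[of r p] elems_check_of[OF 1(1)] by blast
    then obtain q \<rho> where "(q, p) \<in> r" "\<rho> \<in> T" "forces_eq r q \<pi> \<rho>"
      using le_refl[OF po \<open>p \<in> P\<close>] unfolding forces_mem_check_of[OF T(2)] by blast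
    then show "\<pi> \<in> T"
      using "1.IH" T(3) \<open>\<pi> \<in> S\<close> le_carrier[OF po] by blast
  next
    fix \<rho> assume "\<rho> \<in> T"
    then have "forces_mem r p \<rho> (check_of S)"
      using eq le_refl[OF po \<open>p \<in> P\<close>]
      unfolding forces_eq.simps[of r p] elems_check_of[OF T(2)] by blast
    then obtain q \<pi> where q: "(q, p) \<in> r" "\<pi> \<in> S" "forces_eq r q \<rho> \<pi>"
      using le_refl[OF po \<open>p \<in> P\<close>] unfolding forces_mem_check_of[OF 1(1)] by blast
    then have "forces_eq r q \<pi> \<rho>"
      by (simp only: forces_eq_sym)
    then show "\<rho> \<in> S"
      using "1.IH" T(3) \<open>\<rho> \<in> T\<close> q le_carrier[OF po] by blast
  qed
  then show ?case
    unfolding T(1) using forces_eq_refl[OF po] by metis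
qed

lemma forces_eq_pair_name:
  assumes "p \<in> P"
  shows "forces_eq r p (pair_name n m :: ('i, 'p) pname) (pair_name n' m') \<longleftrightarrow> n = n' \<and> m = m'"
  using assms by (simp add: forces_eq_canonical canonical_pair_name pair_name_eq_iff)

lemma forces_mem_real_name:
  assumes "p \<in> P"
  shows "forces_mem r p (pair_name n k :: ('i, 'p) pname) (real_name x) \<longleftrightarrow> k = x n"
proof -
  have "forces_mem r p (pair_name n k :: ('i, 'p) pname) (real_name x) \<longleftrightarrow>
    (\<forall>q. (q, p) \<in> r \<longrightarrow> (\<exists>q' n'. (q', q) \<in> r \<and>
      forces_eq r q' (pair_name n k :: ('i, 'p) pname) (pair_name n' (x n'))))"
    unfolding real_name_def by (subst forces_mem_check_of) auto
  also have "\<dots> \<longleftrightarrow> (\<forall>q. (q, p) \<in> r \<longrightarrow> (\<exists>q' n'. (q', q) \<in> r \<and> n = n' \<and> k = x n'))"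
    using forces_eq_pair_name le_carrier(1)[OF po] by (metis (no_types, opaque_lifting))
  also have "\<dots> \<longleftrightarrow> k = x n"
    using assms le_refl[OF po] le_self[OF po] by blast
  finally show ?thesis .
qed


section \<open>Names for reals\<close>

text \<open>
  Each existential quantifier of the forcing language becomes density; the two quantifiers over
  \<open>n\<close> and \<open>m\<close> in the first clause need only one refinement, by transitivity.
\<close>
lemma forces_is_real:
  fixes \<tau> :: "('i, 'p) pname"
  shows "forces r p (is_real \<tau>) \<longleftrightarrow>
    (\<forall>z q. (q, p) \<in> r \<longrightarrow> forces_mem r q z \<tau> \<longrightarrow>
       (\<exists>q' n m. (q', q) \<in> r \<and> forces_eq r q' z (pair_name n m))) \<and>
    (\<forall>n q. (q, p) \<in> r \<longrightarrow> (\<exists>q' m. (q', q) \<in> r \<and> forces_mem r q' (pair_name n m) \<tau> \<and>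
       (\<forall>m' q''. m' \<noteq> m \<longrightarrow> (q'', q') \<in> r \<longrightarrow> \<not> forces_mem r q'' (pair_name n m') \<tau>)))"
    (is "_ \<longleftrightarrow> ?graph \<and> ?function")
proof -
  have "(\<exists>q'. (q', q) \<in> r \<and> forces r q' (ExNat UNIV (\<lambda>n. ExNat UNIV (\<lambda>m. Eq z (pair_name n m)))))
    \<longleftrightarrow> (\<exists>q' n m. (q', q) \<in> r \<and> forces_eq r q' z (pair_name n m))" (is "?lhs \<longleftrightarrow> ?rhs")
    for q and z :: "('i, 'p) pname"
  proof
    assume ?lhs
    then show ?rhs
      unfolding forces_ExNat forces.simps using le_self[OF po] le_trans[OF po] by meson
  next
    assume ?rhs
    then obtain q' n m where "(q', q) \<in> r" "forces r q' (Eq z (pair_name n m))"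
      by auto
    then show ?lhs
      by (meson UNIV_I forces_ExNatI[OF po])
  qed
  then have "forces r p (AllName (\<lambda>z. Imp (Mem z \<tau>)
          (ExNat UNIV (\<lambda>n. ExNat UNIV (\<lambda>m. Eq z (pair_name n m)))))) \<longleftrightarrow> ?graph"
    by (simp add: forces_Imp)
  moreover have "forces r p (AllNat UNIV (\<lambda>n. ExNat UNIV (\<lambda>m.
          Conj (Mem (pair_name n m) \<tau>)
               (AllNat (- {m}) (\<lambda>m'. Neg (Mem (pair_name n m') \<tau>)))))) \<longleftrightarrow> ?function"
    unfolding forces.simps forces_ExNat by blast
  ultimately show ?thesis
    by (simp add: is_real_def)
qed

text \<open>
  Since \<open>real_name x\<close> is canonical, the value \<open>k\<close> of the left-hand real at \<open>n\<close> can only be \<open>x n\<close>.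
  This removes one existential quantifier, so that both almost domination relations can be
  compared by comparing \<open>x n\<close> with the values forced for \<open>\<tau>\<close>.
\<close>
lemma forces_almost_all_on_real_name:
  fixes \<tau> :: "('i, 'p) pname"
  shows "forces r p (almost_all_on R A (real_name x) \<tau>) \<longleftrightarrow>
    (\<forall>q. (q, p) \<in> r \<longrightarrow> (\<exists>q' N. (q', q) \<in> r \<and> (\<forall>n \<in> A. N \<le> n \<longrightarrow>
      (\<forall>q1. (q1, q') \<in> r \<longrightarrow> (\<exists>q2 m. (q2, q1) \<in> r \<and> R (x n) m \<and> forces_mem r q2 (pair_name n m) \<tau>)))))"
proof -
  have inner: "forces r q (ExNat UNIV (\<lambda>k. ExNat {m. R k m} (\<lambda>m.
         Conj (Mem (pair_name n k) (real_name x)) (Mem (pair_name n m) \<tau>)))) \<longleftrightarrow>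
    (\<forall>q1. (q1, q) \<in> r \<longrightarrow> (\<exists>q2 m. (q2, q1) \<in> r \<and> R (x n) m \<and> forces_mem r q2 (pair_name n m) \<tau>))"
    (is "?lhs \<longleftrightarrow> ?rhs") for q n
  proof
    assume L: ?lhs
    show ?rhs
    proof (intro allI impI)
      fix q1 assume "(q1, q) \<in> r"
      with L obtain q2 k where q2: "(q2, q1) \<in> r" 
        "forces r q2 (ExNat {m. R k m} (\<lambda>m.
         Conj (Mem (pair_name n k) (real_name x)) (Mem (pair_name n m) \<tau>)))"
        unfolding forces_ExNat[of r q] by blast
      then obtain q3 m where "(q3, q2) \<in> r" "R k m" "forces_mem r q3 (pair_name n m) \<tau>"
        "forces_mem r q3 (pair_name n k :: ('i, 'p) pname) (real_name x)"
        using le_self[OF po q2(1)] unfolding forces_ExNat[of r q2] forces.simps by blast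
      then show "\<exists>q2 m. (q2, q1) \<in> r \<and> R (x n) m \<and> forces_mem r q2 (pair_name n m) \<tau>"
        using q2(1) le_trans[OF po] le_carrier(1)[OF po] forces_mem_real_name[of q3 n k x] by metis
    qed
  next
    assume R: ?rhs
    show ?lhs
      unfolding forces_ExNat[of r q]
    proof (intro allI impI)
      fix q1 assume "(q1, q) \<in> r"
      with R obtain q2 m where q2: "(q2, q1) \<in> r" "R (x n) m" "forces_mem r q2 (pair_name n m) \<tau>"
        by blast
      have "forces_mem r q2 (pair_name n (x n) :: ('i, 'p) pname) (real_name x)"
        using forces_mem_real_name[of q2 n "x n" x] le_carrier(1)[OF po q2(1)] by simp
      then have "forces r q2 (ExNat {m. R (x n) m} (\<lambda>m.
         Conj (Mem (pair_name n (x n)) (real_name x)) (Mem (pair_name n m) \<tau>)))"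
        using q2 by (intro forces_ExNatI[OF po, of m]) auto
      then show "\<exists>q'. \<exists>k\<in>UNIV. (q', q1) \<in> r \<and> forces r q' (ExNat {m. R k m} (\<lambda>m.
         Conj (Mem (pair_name n k) (real_name x)) (Mem (pair_name n m) \<tau>)))"
        using q2(1) by blast
    qed
  qed
  show ?thesis
    unfolding almost_all_on_def forces_ExNat[of r p] forces.simps inner
    by (simp add: Ball_def imp_conjL)
qed

text \<open>
  The nice name of a real: \<open>D n m s\<close> says that \<open>s\<close> is one of the conditions that put \<open>m\<close> as the
  value at \<open>n\<close>.
\<close>
definition nice_name :: "(nat \<Rightarrow> nat \<Rightarrow> 'p \<Rightarrow> bool) \<Rightarrow> ('i, 'p) pname" where
  "nice_name D = name_of {(pair_name n m, s) | n m s. D n m s}"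

lemma elems_nice_name: "elems (nice_name D :: ('i, 'p) pname) = {(pair_name n m, s) | n m s. D n m s}"
proof -
  have "fst ` {(pair_name n m, s) | n m s. D n m s} \<subseteq> range (\<lambda>(n, m). pair_name n m :: ('i, 'p) pname)"
    by force
  then have "countable (fst ` {(pair_name n m :: ('i, 'p) pname, s) | n m s. D n m s})"
    by (rule countable_subset) simp
  then show ?thesis
    unfolding nice_name_def by (rule elems_name_of[OF inf])
qed

lemma forces_mem_nice_name:
  assumes "\<And>n m s s'. D n m s \<Longrightarrow> (s', s) \<in> r \<Longrightarrow> D n m s'"
  shows "forces_mem r p (pair_name n m) (nice_name D :: ('i, 'p) pname) \<longleftrightarrow>
    (\<forall>q. (q, p) \<in> r \<longrightarrow> (\<exists>q'. (q', q) \<in> r \<and> D n m q'))"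
proof -
  have *: "(\<exists>(\<rho>, u)\<in>elems (nice_name D :: ('i, 'p) pname). (q', u) \<in> r \<and> forces_eq r q' (pair_name n m) \<rho>) \<longleftrightarrow> D n m q'"
    if "q' \<in> P" for q'
  proof
    assume "\<exists>(\<rho>, u)\<in>elems (nice_name D :: ('i, 'p) pname). (q', u) \<in> r \<and> forces_eq r q' (pair_name n m) \<rho>"
    then obtain n' m' u where "D n' m' u" "(q', u) \<in> r"
      "forces_eq r q' (pair_name n m :: ('i, 'p) pname) (pair_name n' m')"
      unfolding elems_nice_name by blast
    then show "D n m q'"
      using assms forces_eq_pair_name[OF that] by simp
  next
    assume "D n m q'"
    then have "(pair_name n m, q') \<in> elems (nice_name D :: ('i, 'p) pname)"
      unfolding elems_nice_name by blast
    then show "\<exists>(\<rho>, u)\<in>elems (nice_name D :: ('i, 'p) pname). (q', u) \<in> r \<and> forces_eq r q' (pair_name n m) \<rho>"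
      using le_refl[OF po that] forces_eq_refl[OF po] by blast
  qed
  have "(q', q) \<in> r \<and> (\<exists>(\<rho>, u)\<in>elems (nice_name D :: ('i, 'p) pname). (q', u) \<in> r \<and> forces_eq r q' (pair_name n m) \<rho>)
      \<longleftrightarrow> (q', q) \<in> r \<and> D n m q'" for q' q
    using * le_carrier(1)[OF po] by metis
  then show ?thesis
    by (simp only: forces_mem.simps[of r p])
qed

text \<open>
  A condition in \<open>{s. D n m s}\<close> decides the value at \<open>n\<close>: if a stronger one forced another value \<open>m'\<close>,
  a still stronger one would lie in \<open>{s. D n m' s}\<close> and, as these sets are open, in both.
\<close>
lemma is_name_for_real_nice_name:
  assumes down: "\<And>n m s s'. D n m s \<Longrightarrow> (s', s) \<in> r \<Longrightarrow> D n m s'"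
    and total: "\<And>n p. p \<in> P \<Longrightarrow> \<exists>q m. (q, p) \<in> r \<and> D n m q"
    and unique: "\<And>n m m' p. p \<in> P \<Longrightarrow> D n m p \<Longrightarrow> D n m' p \<Longrightarrow> m = m'"
  shows "is_name_for_real P r (nice_name D :: ('i, 'p) pname)"
  unfolding is_name_for_real_def forces_is_real
proof (intro ballI conjI allI impI)
  fix p q and z :: "('i, 'p) pname"
  assume "(q, p) \<in> r" "forces_mem r q z (nice_name D :: ('i, 'p) pname)"
  then show "\<exists>q' n m. (q', q) \<in> r \<and> forces_eq r q' z (pair_name n m)"
    using le_self[OF po] unfolding forces_mem.simps[of r q] elems_nice_name by blast
next
  fix p n q
  assume "(q, p) \<in> r"
  then obtain q' m where q': "(q', q) \<in> r" "D n m q'"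
    using total le_carrier[OF po] by blast
  have mem: "forces_mem r p (pair_name n m) (nice_name D :: ('i, 'p) pname) \<longleftrightarrow>
      (\<forall>q. (q, p) \<in> r \<longrightarrow> (\<exists>q'. (q', q) \<in> r \<and> D n m q'))" for p n m
    by (rule forces_mem_nice_name) (rule down)
  have "forces_mem r q' (pair_name n m) (nice_name D :: ('i, 'p) pname)"
    unfolding mem using q'(2) down le_self[OF po] by blast
  moreover have "\<not> forces_mem r q'' (pair_name n m') (nice_name D :: ('i, 'p) pname)"
    if "m' \<noteq> m" "(q'', q') \<in> r" for m' q''
    unfolding mem
    using that q'(2) down unique le_self[OF po] le_carrier[OF po] by meson
  ultimately show "\<exists>q' m. (q', q) \<in> r \<and> forces_mem r q' (pair_name n m) (nice_name D :: ('i, 'p) pname) \<and>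
      (\<forall>m' q''. m' \<noteq> m \<longrightarrow> (q'', q') \<in> r \<longrightarrow> \<not> forces_mem r q'' (pair_name n m') (nice_name D :: ('i, 'p) pname))"
    using q'(1) by blast
qed

text \<open>
  A name that is a real only below \<open>q\<close> can be mixed with the zero function: the new name follows
  \<open>\<tau>\<close> below \<open>q\<close> and takes the value \<open>0\<close> at conditions incompatible with \<open>q\<close>. These conditions
  together are dense.
\<close>
lemma name_for_real_below:
  fixes \<tau> :: "('i, 'p) pname"
  assumes q: "q \<in> P" and \<tau>: "forces r q (is_real \<tau>)"
  obtains f :: "('i, 'p) pname" where "is_name_for_real P r f"
    and "\<And>p n m. (p, q) \<in> r \<Longrightarrow> forces_mem r p (pair_name n m) f \<longleftrightarrow> forces_mem r p (pair_name n m) \<tau>"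
proof -
  define D where "D n m s \<longleftrightarrow> (if (s, q) \<in> r then forces_mem r s (pair_name n m) \<tau>
    else s \<in> P \<and> (\<forall>t. (t, s) \<in> r \<longrightarrow> (t, q) \<notin> r) \<and> m = 0)" for n m s
  have tau_values: "\<exists>p' m. (p', p) \<in> r \<and> forces_mem r p' (pair_name n m) \<tau> \<and>
       (\<forall>m' p''. m' \<noteq> m \<longrightarrow> (p'', p') \<in> r \<longrightarrow> \<not> forces_mem r p'' (pair_name n m') \<tau>)"
    if "(p, q) \<in> r" for p n
    using \<tau> that unfolding forces_is_real by blast
  have down: "D n m s'" if "D n m s" "(s', s) \<in> r" for n m s s'
  proof (cases "(s, q) \<in> r")
    case True
    then show ?thesis
      using that forces_mem_mono[OF po] le_trans[OF po that(2) True] unfolding D_def by simp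
  next
    case False
    then have s: "\<And>t. (t, s) \<in> r \<Longrightarrow> (t, q) \<notin> r" "m = 0"
      using that(1) unfolding D_def by auto
    moreover have "(t, q) \<notin> r" if "(t, s') \<in> r" for t
      using s(1) le_trans[OF po that \<open>(s', s) \<in> r\<close>] by blast
    ultimately show ?thesis
      using that(2) le_carrier(1)[OF po that(2)] unfolding D_def by simp
  qed
  have total: "\<exists>s m. (s, p) \<in> r \<and> D n m s" if "p \<in> P" for n p
  proof (cases "\<exists>t. (t, p) \<in> r \<and> (t, q) \<in> r")
    case True
    then obtain t where t: "(t, p) \<in> r" "(t, q) \<in> r"
      by blast
    with tau_values obtain s m where "(s, t) \<in> r" "forces_mem r s (pair_name n m) \<tau>"
      by blast
    with t show ?thesis
      unfolding D_def using le_trans[OF po] by meson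
  next
    case False
    then show ?thesis
      unfolding D_def using that le_refl[OF po] by metis
  qed
  have unique: "m = m'" if "p \<in> P" "D n m p" "D n m' p" for n m m' p
  proof (cases "(p, q) \<in> r")
    case True
    then obtain p' k where "(p', p) \<in> r"
      "\<forall>m' p''. m' \<noteq> k \<longrightarrow> (p'', p') \<in> r \<longrightarrow> \<not> forces_mem r p'' (pair_name n m') \<tau>"
      using tau_values by blast
    then show ?thesis
      using that(2,3) True forces_mem_mono[OF po] le_self[OF po] unfolding D_def by metis
  qed (use that in \<open>auto simp: D_def\<close>)
  have mem: "forces_mem r p (pair_name n m) (nice_name D :: ('i, 'p) pname) \<longleftrightarrow>
      (\<forall>q. (q, p) \<in> r \<longrightarrow> (\<exists>q'. (q', q) \<in> r \<and> D n m q'))" for p n m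
    by (rule forces_mem_nice_name) (rule down)
  have below: "forces_mem r p (pair_name n m) (nice_name D :: ('i, 'p) pname) \<longleftrightarrow> forces_mem r p (pair_name n m) \<tau>"
    if "(p, q) \<in> r" for p n m
  proof -
    have "(\<exists>p''. (p'', p') \<in> r \<and> D n m p'') \<longleftrightarrow>
        (\<exists>p''. (p'', p') \<in> r \<and> forces_mem r p'' (pair_name n m) \<tau>)" if "(p', p) \<in> r" for p'
      using le_trans[OF po _ le_trans[OF po that \<open>(p, q) \<in> r\<close>]] unfolding D_def by auto
    then show ?thesis
      unfolding mem
      using forces_mem_dense[OF po, of p] forces_mem_mono[OF po] le_self[OF po] by blast
  qed
  have "is_name_for_real P r (nice_name D :: ('i, 'p) pname)"
    by (rule is_name_for_real_nice_name) (fact down, fact total, fact unique)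
  then show ?thesis
    using below by (rule that)
qed


section \<open>The two implications\<close>

text \<open>
  An unbounded ground model family is not bounded by \<open>g\<close>, and the set where some member exceeds
  \<open>g\<close> is exactly the infinite set \<open>A\<close> at which almost bounding has to be applied.
\<close>
lemma almost_bounding_no_forced_bound:
  fixes y :: "('i, 'p) pname"
  assumes bounding: "almost_bounding TYPE('i) P r" and X: "unbounded X"
    and s: "s \<in> P" and y: "forces r s (is_real y)"
    and bound: "\<And>x. x \<in> X \<Longrightarrow> forces r s (le_star_sentence (real_name x) y)"
  shows False
proof -
  obtain f :: "('i, 'p) pname" where f: "is_name_for_real P r f"
    and f_y: "\<And>p n m. (p, s) \<in> r \<Longrightarrow>
      forces_mem r p (pair_name n m) f \<longleftrightarrow> forces_mem r p (pair_name n m) y"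
    using name_for_real_below[OF s y] by blast
  obtain g where g: "\<And>A. infinite A \<Longrightarrow>
      \<exists>t. (t, s) \<in> r \<and> forces r t (Neg (less_star_on A (real_name g) f))"
    using bounding f s unfolding almost_bounding_def by blast
  obtain x where x: "x \<in> X" "\<not> le_star x g"
    using X unfolding unbounded_def by blast
  \<comment> \<open>On this set the bound of \<open>x\<close> by \<open>y\<close> would put \<open>g\<close> strictly below \<open>f\<close>.\<close>
  define A where "A = {n. g n < x n}"
  have "infinite A"
    using x(2) unfolding le_star_def A_def by (simp add: not_le eventually_cofinite)
  then obtain t where t: "(t, s) \<in> r" "forces r t (Neg (less_star_on A (real_name g) f))"
    using g by blast
  have less: "forces r t (less_star_on A (real_name g) f)"
    unfolding forces_almost_all_on_real_name
  proof (intro allI impI)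
    fix u assume "(u, t) \<in> r"
    then obtain u' N where u': "(u', u) \<in> r" "\<And>n v. N \<le> n \<Longrightarrow> (v, u') \<in> r \<Longrightarrow>
        \<exists>w m. (w, v) \<in> r \<and> x n \<le> m \<and> forces_mem r w (pair_name n m) y"
      using bound[OF x(1)] le_trans[OF po _ t(1)] unfolding forces_almost_all_on_real_name
      by (meson UNIV_I)
    have "\<exists>w m. (w, v) \<in> r \<and> g n < m \<and> forces_mem r w (pair_name n m) f"
      if n: "n \<in> A" "N \<le> n" and v: "(v, u') \<in> r" for n v
    proof -
      obtain w m where w: "(w, v) \<in> r" "x n \<le> m" "forces_mem r w (pair_name n m) y"
        using u'(2) n(2) v by blast
      moreover have "(w, s) \<in> r"
        using le_trans[OF po w(1)] le_trans[OF po v] le_trans[OF po u'(1)]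
          le_trans[OF po \<open>(u, t) \<in> r\<close> t(1)] by simp
      ultimately show ?thesis
        using n(1) f_y[of w n m] unfolding A_def by (auto intro: order_less_le_trans)
    qed
    then show "\<exists>u' N. (u', u) \<in> r \<and> (\<forall>n\<in>A. N \<le> n \<longrightarrow> (\<forall>v. (v, u') \<in> r \<longrightarrow>
        (\<exists>w m. (w, v) \<in> r \<and> g n < m \<and> forces_mem r w (pair_name n m) f)))"
      using u'(1) by blast
  qed
  have "\<forall>u. (u, t) \<in> r \<longrightarrow> \<not> forces r u (less_star_on A (real_name g) f)"
    using t(2) by (simp only: forces.simps)
  from this[rule_format, OF le_self[OF po t(1)]] less show False
    by contradiction
qed

lemma almost_bounding_imp_preserves_unbounded:
  assumes "almost_bounding TYPE('i) P r"
  shows "preserves_unbounded TYPE('i) P r"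
proof -
  have "forces r p (unbounded_sentence X :: ('i, 'p) sentence)" if X: "unbounded X" for X p
  proof -
    have "\<not> forces r q (ExName (\<lambda>y :: ('i, 'p) pname.
        Conj (is_real y) (AllReal X (\<lambda>x. le_star_sentence (real_name x) y))))" if "(q, p) \<in> r" for q
    proof
      assume "forces r q (ExName (\<lambda>y :: ('i, 'p) pname.
        Conj (is_real y) (AllReal X (\<lambda>x. le_star_sentence (real_name x) y))))"
      then obtain s and y :: "('i, 'p) pname" where "(s, q) \<in> r"
        and "forces r s (Conj (is_real y) (AllReal X (\<lambda>x. le_star_sentence (real_name x) y)))"
        using le_self[OF po \<open>(q, p) \<in> r\<close>] unfolding forces_ExName by blast
      then show False
        using almost_bounding_no_forced_bound[OF assms X, of s y] le_carrier(1)[OF po] by simp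
    qed
    then show ?thesis
      by (simp only: unbounded_sentence_def forces.simps) simp
  qed
  then show ?thesis
    by (simp add: preserves_unbounded_def)
qed

text \<open>
  If \<open>f\<close> strictly dominates each \<open>g\<close> on some infinite set \<open>A g\<close>, then it bounds the functions that are
  \<open>g\<close> on \<open>A g\<close> and zero elsewhere. The choice of \<open>A g\<close> is made in the ground model, so
  these functions form a ground model family, and a diagonal argument shows it to be unbounded.
\<close>
lemma preserves_unbounded_imp_almost_bounding:
  assumes "preserves_unbounded TYPE('i) P r"
  shows "almost_bounding TYPE('i) P r"
  unfolding almost_bounding_def
proof (intro allI impI ballI, rule ccontr)
  fix f :: "('i, 'p) pname" and q
  assume f: "is_name_for_real P r f" and q: "q \<in> P"
    and neg: "\<not> (\<exists>g. \<forall>A. infinite A \<longrightarrow>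
      (\<exists>t. (t, q) \<in> r \<and> forces r t (Neg (less_star_on A (real_name g) f))))"
  have "\<exists>A. infinite A \<and> (\<forall>t. (t, q) \<in> r \<longrightarrow>
      (\<exists>t'. (t', t) \<in> r \<and> forces r t' (less_star_on A (real_name g) f)))" for g
  proof -
    from neg have "\<not> (\<forall>A. infinite A \<longrightarrow>
        (\<exists>t. (t, q) \<in> r \<and> forces r t (Neg (less_star_on A (real_name g) f))))"
      by (rule contrapos_nn) (rule exI)
    then obtain A where "infinite A"
      and A: "\<And>t. (t, q) \<in> r \<Longrightarrow> \<not> forces r t (Neg (less_star_on A (real_name g) f))"
      by (auto simp only: not_all not_imp not_ex de_Morgan_conj)
    have "\<exists>t'. (t', t) \<in> r \<and> forces r t' (less_star_on A (real_name g) f)" if "(t, q) \<in> r" for t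
      using A[OF that] unfolding forces.simps(3) by blast
    with \<open>infinite A\<close> show ?thesis
      by meson
  qed
  then obtain A where inf_A: "\<And>g. infinite (A g)"
    and dominated: "\<And>g t. (t, q) \<in> r \<Longrightarrow>
      \<exists>t'. (t', t) \<in> r \<and> forces r t' (less_star_on (A g) (real_name g) f)"
    by metis
  \<comment> \<open>The value \<open>0\<close> off \<open>A g\<close> makes domination by \<open>f\<close> trivial where nothing is known about \<open>g\<close>.\<close>
  define x where "x g n = (if n \<in> A g then g n else 0)" for g n
  have "unbounded (range x)"
    unfolding unbounded_def
  proof
    assume "\<exists>y. \<forall>z \<in> range x. le_star z y"
    then obtain y where "\<forall>\<^sub>\<infinity>n. x (\<lambda>n. Suc (y n)) n \<le> y n"
      unfolding le_star_def by blast
    then have "finite {n. \<not> x (\<lambda>n. Suc (y n)) n \<le> y n}"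
      by (simp add: eventually_cofinite)
    moreover have "A (\<lambda>n. Suc (y n)) \<subseteq> {n. \<not> x (\<lambda>n. Suc (y n)) n \<le> y n}"
      by (auto simp: x_def)
    ultimately show False
      using inf_A finite_subset by blast
  qed
  then have "forces r q (unbounded_sentence (range x) :: ('i, 'p) sentence)"
    using assms q unfolding preserves_unbounded_def by blast
  moreover have "forces r q (le_star_sentence (real_name (x g)) f)" for g
    unfolding forces_almost_all_on_real_name
  proof (intro allI impI)
    fix t assume "(t, q) \<in> r"
    then obtain t' where t': "(t', t) \<in> r" "forces r t' (less_star_on (A g) (real_name g) f)"
      using dominated by blast
    then obtain u N where u: "(u, t') \<in> r" "\<And>n v. n \<in> A g \<Longrightarrow> N \<le> n \<Longrightarrow> (v, u) \<in> r \<Longrightarrow>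
        \<exists>w m. (w, v) \<in> r \<and> g n < m \<and> forces_mem r w (pair_name n m) f"
      using le_self[OF po t'(1)] unfolding forces_almost_all_on_real_name by meson
    have "\<exists>w m. (w, v) \<in> r \<and> x g n \<le> m \<and> forces_mem r w (pair_name n m) f"
      if "N \<le> n" "(v, u) \<in> r" for n v
    proof (cases "n \<in> A g")
      case True
      then obtain w m where "(w, v) \<in> r" "g n < m" "forces_mem r w (pair_name n m) f"
        using u(2) \<open>N \<le> n\<close> \<open>(v, u) \<in> r\<close> by blast
      then show ?thesis
        unfolding x_def by (auto intro: less_imp_le)
    next
      case False
      have "forces r v (is_real f)"
        using f le_carrier(1)[OF po \<open>(v, u) \<in> r\<close>] unfolding is_name_for_real_def by blast
      then obtain w m where "(w, v) \<in> r" "forces_mem r w (pair_name n m) f"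
        using le_self[OF po \<open>(v, u) \<in> r\<close>] unfolding forces_is_real by blast
      then show ?thesis
        using False unfolding x_def by auto
    qed
    then show "\<exists>q' N. (q', t) \<in> r \<and> (\<forall>n\<in>UNIV. N \<le> n \<longrightarrow> (\<forall>v. (v, q') \<in> r \<longrightarrow>
        (\<exists>w m. (w, v) \<in> r \<and> x g n \<le> m \<and> forces_mem r w (pair_name n m) f)))"
      using le_trans[OF po u(1) t'(1)] by blast
  qed
  then have "forces r t (Conj (is_real f) (AllReal (range x) (\<lambda>x. le_star_sentence (real_name x) f)))"
    if "(t, q) \<in> r" for t
    using f forces_mono[OF po _ that] le_carrier(1)[OF po that] unfolding is_name_for_real_def by auto
  then have "forces r q (ExName (\<lambda>y :: ('i, 'p) pname.
      Conj (is_real y) (AllReal (range x) (\<lambda>x. le_star_sentence (real_name x) y))))"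
    unfolding forces_ExName using le_self[OF po] by blast
  ultimately show False
    using le_refl[OF po q] unfolding unbounded_sentence_def by auto
qed

end
end

theorem lemma1p3:
  fixes P :: "'p set" and r :: "'p rel"
  assumes "partial_order_on P r"
    and "infinite (UNIV :: 'i set)"
  shows "almost_bounding TYPE('i) P r \<longleftrightarrow> preserves_unbounded TYPE('i) P r"
  by (rule iffI) (fact almost_bounding_imp_preserves_unbounded[OF assms(2,1)],
      fact preserves_unbounded_imp_almost_bounding[OF assms(2,1)])

end
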